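(* Let $t_0<T<+\infty$ and let $a,b,c,d$ be real-valued continuous functions on $[t_0,T]$. Assume: (1) $a(t)>0$ almost everywhere on $[t_0,T]$; (2) $\frac{b^2(t)}{a(t)}$ is integrable on $[t_0,T]$; (3) $\displaystyle\int_{t_0}^{T}\Big[c(t)-\frac{b^2(t)}{4a(t)}\Big]dt>0$; (4) $d(t)\le0$ for all $t\in[t_0,T]$. Then the equation $$y'+a(t)y^3+b(t)y^2+c(t)y+d(t)=0$$ has a nonnegative closed solution on $[t_0,T]$.
   Context: A solution $y(t)$ of the equation, existing on an interval $[t_0,T]$, is called closed on $[t_0,T]$ if $y(t_0)=y(T)$. A solution on an interval is a real-valued differentiable function satisfying the equation at every point of the interval (one-sided derivatives at the endpoints). "Integrable" means Lebesgue integrable. *)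

theory Defs
  imports "HOL-Analysis.Analysis"
begin

text \<open>The derivative is taken within the closed interval, hence is one-sided at the endpoints.\<close>

definition abel_solution_on ::
  "real set \<Rightarrow> (real \<Rightarrow> real) \<Rightarrow> (real \<Rightarrow> real) \<Rightarrow> (real \<Rightarrow> real) \<Rightarrow> (real \<Rightarrow> real) \<Rightarrow> (real \<Rightarrow> real) \<Rightarrow> bool"
  where
  "abel_solution_on I a b c d y \<longleftrightarrow>
     (\<forall>t\<in>I. \<exists>y'. (y has_real_derivative y') (at t within I) \<and>
        y' + a t * y t ^ 3 + b t * y t ^ 2 + c t * y t + d t = 0)"

definition closed_abel_solution_on ::
  "real \<Rightarrow> real \<Rightarrow> (real \<Rightarrow> real) \<Rightarrow> (real \<Rightarrow> real) \<Rightarrow> (real \<Rightarrow> real) \<Rightarrow> (real \<Rightarrow> real) \<Rightarrow> (real \<Rightarrow> real) \<Rightarrow> bool"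
  where
  "closed_abel_solution_on t0 T a b c d y \<longleftrightarrow>
     abel_solution_on {t0..T} a b c d y \<and> y t0 = y T"

end

theory Submission
  imports Defs
begin

text \<open>
  Write the equation as \<open>y' = f t y\<close> with \<open>f t y = - (a t * y^3 + b t * y^2 + c t * y + d t)\<close>.
  The constant \<open>0\<close> is a lower solution because \<open>d \<le> 0\<close>. Completing the square,
  \<open>a y^2 + b y + c \<ge> c - b^2 / (4 a)\<close>, shows that for \<open>y \<ge> 0\<close> the equation is dominated by the linear
  one with coefficient \<open>c - b^2 / (4 a)\<close>. This coefficient has positive mean, so the linear equation
  contracts over a period and has a periodic nonnegative solution, which is an upper solution of the
  nonlinear equation. Between ordered lower and upper solutions there is a closed solution.

  The last step uses monotone iteration, which avoids initial value problems and the Poincare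
  map. For \<open>K\<close> large, \<open>f t y + K y\<close> increases in \<open>y\<close> on the relevant range, so the map sending \<open>u\<close> to the periodic solution of \<open>y' + K y = f t u + K u\<close> is order preserving. That solution
  is given by an explicit formula. Iterating from the upper solution yields a decreasing
  sequence bounded below by the lower solution, and by dominated convergence its pointwise limit is
  a fixed point, that is, a closed solution
  (\<open>closed_solution_between_lower_and_upper\<close>).

  The coefficient \<open>c - b^2 / (4 a)\<close> is only integrable, so its linear equation would only have
  absolutely continuous solutions. To obtain a continuously differentiable upper solution, \<open>a\<close> is replaced
  by \<open>a + \<epsilon>\<close> in the denominator. The error this causes is \<open>\<epsilon> y^2\<close>, and it is absorbed by giving away
  half of the positive mean, since the upper solution is bounded independently of \<open>\<epsilon>\<close>
  (\<open>bounded_upper_solution\<close>).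
\<close>

section \<open>Periodic solutions of scalar linear equations\<close>

locale periodic_linear =
  fixes t0 T :: real and p :: "real \<Rightarrow> real"
  assumes interval: "t0 < T"
    and p_cont: "continuous_on {t0..T} p"
    and p_mean_pos: "integral {t0..T} p > 0"
begin

definition P :: "real \<Rightarrow> real" where
  "P t = integral {t0..t} p"

text \<open>
  The solution of \<open>y' + p y = g\<close> with \<open>y t0 = y T\<close>, by variation of constants. The first summand
  is the initial value \<open>w\<close>, determined by \<open>exp (P T) * w = w + (integral of exp P * g)\<close>; this is
  solvable because \<open>P T > 0\<close>.
\<close>

definition response :: "(real \<Rightarrow> real) \<Rightarrow> real \<Rightarrow> real" where
  "response g t = exp (- P t) *
     (integral {t0..T} (\<lambda>s. exp (P s) * g s) / (exp (P T) - 1)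
       + integral {t0..t} (\<lambda>s. exp (P s) * g s))"

lemma P_t0 [simp]: "P t0 = 0"
  by (simp add: P_def)

lemma P_T_pos: "P T > 0"
  using p_mean_pos by (simp add: P_def)

lemma P_deriv:
  "t \<in> {t0..T} \<Longrightarrow> (P has_real_derivative p t) (at t within {t0..T})"
  unfolding P_def by (rule integral_has_real_derivative[OF p_cont])

lemma P_cont: "continuous_on {t0..T} P"
  using P_deriv by (intro DERIV_continuous_on)

lemma weighted_cont:
  "continuous_on {t0..T} g \<Longrightarrow> continuous_on {t0..T} (\<lambda>s. exp (P s) * g s)"
  by (intro continuous_intros P_cont)

lemma weighted_integrable:
  "continuous_on {t0..T} g \<Longrightarrow> (\<lambda>s. exp (P s) * g s) integrable_on {t0..T}"
  by (intro integrable_continuous_real weighted_cont)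

lemma response_deriv:
  assumes "continuous_on {t0..T} g" "t \<in> {t0..T}"
  shows "(response g has_real_derivative g t - p t * response g t) (at t within {t0..T})"
  unfolding response_def
  by (rule derivative_eq_intros P_deriv integral_has_real_derivative[OF weighted_cont] assms refl)+
     (simp add: algebra_simps flip: exp_add)

lemma response_closed: "response g t0 = response g T"
proof -
  have "exp (P T) - 1 > 0" using P_T_pos by simp
  then show ?thesis by (simp add: response_def exp_minus field_simps)
qed

text \<open>
  Integrability of the weighted function, rather than continuity, is what is known a priori for the pointwise
  limit of an iteration.
\<close>

lemma response_continuous:
  assumes "(\<lambda>s. exp (P s) * g s) integrable_on {t0..T}"
  shows "continuous_on {t0..T} (response g)"
  unfolding response_def
  by (intro continuous_intros P_cont indefinite_integral_continuous_1 assms)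

lemma response_mono:
  assumes f: "(\<lambda>s. exp (P s) * f s) integrable_on {t0..T}"
    and g: "(\<lambda>s. exp (P s) * g s) integrable_on {t0..T}"
    and le: "\<And>s. s \<in> {t0..T} \<Longrightarrow> f s \<le> g s" and t: "t \<in> {t0..T}"
  shows "response f t \<le> response g t"
proof -
  have sub: "integral {t0..r} (\<lambda>s. exp (P s) * f s) \<le> integral {t0..r} (\<lambda>s. exp (P s) * g s)"
    if "r \<in> {t0..T}" for r
    using that le by (intro integral_le integrable_on_subinterval[OF f] integrable_on_subinterval[OF g]) auto
  show ?thesis
    unfolding response_def using P_T_pos interval
    by (intro mult_left_mono add_mono divide_right_mono sub t) auto
qed

text \<open>
  With the integrating factor the differential inequality says that \<open>exp P * u\<close> grows at least as
  fast as the integral of \<open>exp P * g\<close>. Over the whole period, together with \<open>u T \<le> u t0\<close>, this forces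
  \<open>u t0\<close> to be at least the initial value of the periodic solution; the inequality then propagates
  to every \<open>t\<close>.
\<close>

lemma response_le_upper:
  assumes g: "continuous_on {t0..T} g"
    and u: "\<And>t. t \<in> {t0..T} \<Longrightarrow> (u has_real_derivative u' t) (at t within {t0..T})"
    and ineq: "\<And>t. t \<in> {t0..T} \<Longrightarrow> g t - p t * u t \<le> u' t"
    and ends: "u T \<le> u t0" and t: "t \<in> {t0..T}"
  shows "response g t \<le> u t"
proof -
  define I where "I r = integral {t0..r} (\<lambda>s. exp (P s) * g s)" for r
  define W where "W r = exp (P r) * u r - I r" for r
  have I: "(I has_real_derivative exp (P r) * g r) (at r within {t0..T})" if "r \<in> {t0..T}" for r
    unfolding I_def by (rule integral_has_real_derivative[OF weighted_cont[OF g] that])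
  have W: "(W has_real_derivative exp (P r) * (u' r + p r * u r - g r)) (at r within {t0..T})"
    if "r \<in> {t0..T}" for r
    unfolding W_def
    by (rule derivative_eq_intros P_deriv u I that refl)+ (simp add: algebra_simps)
  have Wc: "continuous_on {t0..T} W"
    using W by (intro DERIV_continuous_on)
  have W_ge: "u t0 \<le> W r" if r: "r \<in> {t0..T}" for r
  proof -
    have "W t0 \<le> W r"
    proof (rule DERIV_nonneg_imp_increasing_open[where f = W])
      show "t0 \<le> r" using r by simp
      show "continuous_on {t0..r} W" by (rule continuous_on_subset[OF Wc]) (use r in auto)
      fix x assume x: "t0 < x" "x < r"
      then have "(W has_real_derivative exp (P x) * (u' x + p x * u x - g x)) (at x)"
        using W[of x] r by (simp add: at_within_Icc_at)
      moreover have "exp (P x) * (u' x + p x * u x - g x) \<ge> 0"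
        using ineq[of x] x r by simp
      ultimately show "\<exists>y. (W has_real_derivative y) (at x) \<and> 0 \<le> y" by blast
    qed
    then show ?thesis by (simp add: W_def I_def)
  qed
  have E: "exp (P T) - 1 > 0" using P_T_pos by simp
  have "exp (P T) * u T \<le> exp (P T) * u t0"
    using ends by (intro mult_left_mono) auto
  moreover have "u t0 \<le> exp (P T) * u T - I T"
    using W_ge[of T] interval by (simp add: W_def)
  ultimately have "I T \<le> u t0 * (exp (P T) - 1)"
    unfolding right_diff_distrib mult.commute[of "u t0"] by linarith
  then have "I T / (exp (P T) - 1) \<le> u t0"
    using E by (simp only: pos_divide_le_eq)
  moreover have "u t0 \<le> exp (P t) * u t - I t"
    using W_ge[OF t] unfolding W_def .
  ultimately have "I T / (exp (P T) - 1) + I t \<le> exp (P t) * u t"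
    by linarith
  then have "exp (- P t) * (I T / (exp (P T) - 1) + I t) \<le> exp (- P t) * (exp (P t) * u t)"
    by (intro mult_left_mono) auto
  also have "\<dots> = u t"
    unfolding mult.assoc[symmetric] exp_add[symmetric] by simp
  finally show ?thesis
    unfolding response_def I_def .
qed

lemma response_uminus: "response (\<lambda>s. - g s) t = - response g t"
  by (simp add: response_def algebra_simps)

lemma response_ge_lower:
  assumes g: "continuous_on {t0..T} g"
    and u: "\<And>t. t \<in> {t0..T} \<Longrightarrow> (u has_real_derivative u' t) (at t within {t0..T})"
    and ineq: "\<And>t. t \<in> {t0..T} \<Longrightarrow> u' t \<le> g t - p t * u t"
    and ends: "u t0 \<le> u T" and t: "t \<in> {t0..T}"
  shows "u t \<le> response g t"
proof -
  have "response (\<lambda>s. - g s) t \<le> - u t"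
  proof (rule response_le_upper[where u = "\<lambda>s. - u s" and u' = "\<lambda>s. - u' s"])
    show "continuous_on {t0..T} (\<lambda>s. - g s)" by (intro continuous_intros g)
    show "((\<lambda>s. - u s) has_real_derivative - u' r) (at r within {t0..T})" if "r \<in> {t0..T}" for r
      by (rule derivative_eq_intros u that refl)+
  qed (use ineq ends t in \<open>force+\<close>)
  then show ?thesis by (simp add: response_uminus)
qed

lemma response_nonneg:
  assumes "continuous_on {t0..T} g" "\<And>s. s \<in> {t0..T} \<Longrightarrow> 0 \<le> g s" "t \<in> {t0..T}"
  shows "0 \<le> response g t"
  using response_ge_lower[of g "\<lambda>_. 0" "\<lambda>_. 0" t] assms by simp

text \<open>
  The bound depends on \<open>p\<close> only through \<open>C\<close> and \<open>m\<close>. This gives uniformity in a parameter on which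
  \<open>p\<close> depends.
\<close>

lemma response_bound:
  assumes g: "continuous_on {t0..T} g" and g0: "\<And>s. s \<in> {t0..T} \<Longrightarrow> 0 \<le> g s"
    and C: "\<And>s. s \<in> {t0..T} \<Longrightarrow> \<bar>P s\<bar> \<le> C"
    and m: "0 < m" "m \<le> P T" and t: "t \<in> {t0..T}"
  shows "response g t \<le> exp C * (exp C * integral {t0..T} g * (1 / (exp m - 1) + 1))"
proof -
  define J where "J = integral {t0..T} (\<lambda>s. exp (P s) * g s)"
  have gi: "g integrable_on {t0..T}" by (intro integrable_continuous_real g)
  have "J \<le> integral {t0..T} (\<lambda>s. exp C * g s)"
    unfolding J_def
  proof (intro integral_le weighted_integrable g)
    show "(\<lambda>s. exp C * g s) integrable_on {t0..T}"
      by (intro integrable_continuous_real continuous_intros g)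
    show "exp (P s) * g s \<le> exp C * g s" if "s \<in> {t0..T}" for s
      using C[OF that] g0[OF that] by (intro mult_right_mono) auto
  qed
  then have J: "J \<le> exp C * integral {t0..T} g" by simp
  have J0: "0 \<le> J"
    unfolding J_def using g0 by (intro integral_nonneg weighted_integrable g) auto
  have It: "integral {t0..t} (\<lambda>s. exp (P s) * g s) \<le> J"
    unfolding J_def using t g0
    by (intro integral_subset_le integrable_on_subinterval[OF weighted_integrable[OF g]]
        weighted_integrable g) auto
  have It0: "0 \<le> integral {t0..t} (\<lambda>s. exp (P s) * g s)"
    using t g0
    by (intro integral_nonneg integrable_on_subinterval[OF weighted_integrable[OF g]]) auto
  have e: "0 < exp m - 1" using m by simp
  have q: "J / (exp (P T) - 1) \<le> J / (exp m - 1)"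
    using e m J0 by (intro divide_left_mono) auto
  have "response g t \<le> exp C * (J / (exp m - 1) + J)"
    unfolding response_def J_def[symmetric]
    using C[OF t] q It It0 J0 e P_T_pos by (intro mult_mono add_mono add_nonneg_nonneg) auto
  also have "\<dots> = exp C * (J * (1 / (exp m - 1) + 1))" by (simp add: algebra_simps)
  also have "\<dots> \<le> exp C * (exp C * integral {t0..T} g * (1 / (exp m - 1) + 1))"
    using e J by (intro mult_left_mono mult_right_mono) auto
  finally show ?thesis .
qed

lemma response_dominated_convergence:
  assumes gk: "\<And>k. (\<lambda>s. exp (P s) * g k s) integrable_on {t0..T}"
    and B: "continuous_on {t0..T} B"
    and dom: "\<And>k s. s \<in> {t0..T} \<Longrightarrow> \<bar>g k s\<bar> \<le> B s"
    and lim: "\<And>s. s \<in> {t0..T} \<Longrightarrow> (\<lambda>k. g k s) \<longlonglongrightarrow> l s"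
  shows "(\<lambda>s. exp (P s) * l s) integrable_on {t0..T}"
    and "t \<in> {t0..T} \<Longrightarrow> (\<lambda>k. response (g k) t) \<longlonglongrightarrow> response l t"
proof -
  have *: "(\<lambda>s. exp (P s) * l s) integrable_on {t0..r}"
    "(\<lambda>k. integral {t0..r} (\<lambda>s. exp (P s) * g k s)) \<longlonglongrightarrow> integral {t0..r} (\<lambda>s. exp (P s) * l s)"
    if r: "r \<in> {t0..T}" for r
  proof -
    have 1: "(\<lambda>s. exp (P s) * g k s) integrable_on {t0..r}" for k
      by (rule integrable_on_subinterval[OF gk]) (use r in auto)
    have 2: "(\<lambda>s. exp (P s) * B s) integrable_on {t0..r}"
      by (rule integrable_on_subinterval[OF weighted_integrable[OF B]]) (use r in auto)
    have 3: "norm (exp (P s) * g k s) \<le> exp (P s) * B s" if "s \<in> {t0..r}" for k s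
      using dom[of s k] that r by (simp add: abs_mult)
    have 4: "(\<lambda>k. exp (P s) * g k s) \<longlonglongrightarrow> exp (P s) * l s" if "s \<in> {t0..r}" for s
      by (rule tendsto_mult[OF tendsto_const lim]) (use that r in auto)
    show "(\<lambda>s. exp (P s) * l s) integrable_on {t0..r}"
      "(\<lambda>k. integral {t0..r} (\<lambda>s. exp (P s) * g k s)) \<longlonglongrightarrow> integral {t0..r} (\<lambda>s. exp (P s) * l s)"
      using dominated_convergence[OF 1 2 3 4] by blast+
  qed
  show "(\<lambda>s. exp (P s) * l s) integrable_on {t0..T}"
    using *(1)[of T] interval by simp
  have TT: "T \<in> {t0..T}" using interval by simp
  have "exp (P T) - 1 \<noteq> 0" using P_T_pos by simp
  then show "(\<lambda>k. response (g k) t) \<longlonglongrightarrow> response l t" if "t \<in> {t0..T}"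
    unfolding response_def using that by (intro tendsto_intros *(2) TT)
qed

end

section \<open>Monotone iteration between lower and upper solutions\<close>

text \<open>
  The one-sided Lipschitz condition \<open>mono\<close> makes \<open>u \<mapsto> (periodic solution of y' + K y = f t u + K u)\<close>
  an increasing operator. The differential inequalities for \<open>\<alpha>\<close> and \<open>\<beta>\<close> say that it moves \<open>\<alpha>\<close> up and
  \<open>\<beta>\<close> down, so its iterates from \<open>\<beta>\<close> decrease and stay above \<open>\<alpha>\<close>.
\<close>

theorem closed_solution_between_lower_and_upper:
  fixes f :: "real \<Rightarrow> real \<Rightarrow> real"
  assumes t0T: "t0 < T"
    and f_cont: "continuous_on ({t0..T} \<times> UNIV) (\<lambda>(t, y). f t y)"
    and K: "0 < K"
    and mono: "\<And>t u v. \<lbrakk>t \<in> {t0..T}; \<alpha> t \<le> u; u \<le> v; v \<le> \<beta> t\<rbrakk> \<Longrightarrow> f t u + K * u \<le> f t v + K * v"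
    and \<alpha>: "\<And>t. t \<in> {t0..T} \<Longrightarrow> (\<alpha> has_real_derivative \<alpha>' t) (at t within {t0..T})"
      "\<And>t. t \<in> {t0..T} \<Longrightarrow> \<alpha>' t \<le> f t (\<alpha> t)" "\<alpha> t0 \<le> \<alpha> T"
    and \<beta>: "\<And>t. t \<in> {t0..T} \<Longrightarrow> (\<beta> has_real_derivative \<beta>' t) (at t within {t0..T})"
      "\<And>t. t \<in> {t0..T} \<Longrightarrow> f t (\<beta> t) \<le> \<beta>' t" "\<beta> T \<le> \<beta> t0"
    and \<alpha>\<beta>: "\<And>t. t \<in> {t0..T} \<Longrightarrow> \<alpha> t \<le> \<beta> t"
  shows "\<exists>y. (\<forall>t\<in>{t0..T}. (y has_real_derivative f t (y t)) (at t within {t0..T})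
                \<and> \<alpha> t \<le> y t \<and> y t \<le> \<beta> t) \<and> y t0 = y T"
proof -
  interpret periodic_linear t0 T "\<lambda>_. K"
    using t0T K by unfold_locales (simp_all add: zero_less_mult_iff)
  define h where "h t y = f t y + K * y" for t y
  have h_cont: "continuous_on {t0..T} (\<lambda>t. h t (u t))" if "continuous_on {t0..T} u" for u
  proof -
    have "continuous_on {t0..T} (\<lambda>t. (t, u t))"
      by (intro continuous_on_Pair continuous_on_id that)
    from continuous_on_compose2[OF f_cont this]
    have "continuous_on {t0..T} (\<lambda>t. f t (u t))" by auto
    then show ?thesis
      unfolding h_def by (intro continuous_on_add continuous_on_mult_left that)
  qed
  have h_mono: "h t u \<le> h t v" if "t \<in> {t0..T}" "\<alpha> t \<le> u" "u \<le> v" "v \<le> \<beta> t" for t u v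
    unfolding h_def using mono that by blast
  have \<alpha>c: "continuous_on {t0..T} \<alpha>" and \<beta>c: "continuous_on {t0..T} \<beta>"
    using DERIV_continuous_on[OF \<alpha>(1)] DERIV_continuous_on[OF \<beta>(1)] by auto
  define \<Phi> where "\<Phi> u = response (\<lambda>t. h t (u t))" for u
  have \<Phi>_cont: "continuous_on {t0..T} (\<Phi> u)" if "continuous_on {t0..T} u" for u
    unfolding \<Phi>_def by (intro response_continuous weighted_integrable h_cont that)
  have \<Phi>_mono: "\<Phi> u t \<le> \<Phi> v t"
    if "continuous_on {t0..T} u" "continuous_on {t0..T} v"
      "\<And>s. s \<in> {t0..T} \<Longrightarrow> \<alpha> s \<le> u s \<and> u s \<le> v s \<and> v s \<le> \<beta> s" "t \<in> {t0..T}" for u v t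
    unfolding \<Phi>_def using that
    by (intro response_mono weighted_integrable h_cont h_mono) auto
  have \<Phi>\<beta>: "\<Phi> \<beta> t \<le> \<beta> t" if "t \<in> {t0..T}" for t
    unfolding \<Phi>_def using \<beta> that
    by (intro response_le_upper[where u' = \<beta>'] h_cont \<beta>c) (auto simp: h_def)
  have \<Phi>\<alpha>: "\<alpha> t \<le> \<Phi> \<alpha> t" if "t \<in> {t0..T}" for t
    unfolding \<Phi>_def using \<alpha> that
    by (intro response_ge_lower[where u' = \<alpha>'] h_cont \<alpha>c) (auto simp: h_def)
  define y where "y n = (\<Phi> ^^ n) \<beta>" for n
  have y0: "y 0 = \<beta>" and ySuc: "y (Suc n) = \<Phi> (y n)" for n by (simp_all add: y_def)
  have y_cont: "continuous_on {t0..T} (y n)" for n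
    by (induction n) (simp_all add: y0 ySuc \<beta>c \<Phi>_cont)
  have y_between: "\<forall>t\<in>{t0..T}. \<alpha> t \<le> y n t \<and> y (Suc n) t \<le> y n t \<and> y n t \<le> \<beta> t" for n
  proof (induction n)
    case 0
    then show ?case by (simp add: y0 ySuc \<Phi>\<beta> \<alpha>\<beta>)
  next
    case (Suc n)
    show ?case
    proof
      fix t assume t: "t \<in> {t0..T}"
      have 1: "\<Phi> \<alpha> t \<le> \<Phi> (y n) t"
        using Suc by (intro \<Phi>_mono \<alpha>c y_cont t) auto
      have lo: "\<alpha> s \<le> y (Suc n) s" if s: "s \<in> {t0..T}" for s
      proof -
        have "\<Phi> \<alpha> s \<le> \<Phi> (y n) s"
          using Suc by (intro \<Phi>_mono \<alpha>c y_cont s) auto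
        then show ?thesis using \<Phi>\<alpha>[OF s] by (simp add: ySuc)
      qed
      have "\<Phi> (y (Suc n)) t \<le> \<Phi> (y n) t"
        using Suc lo by (intro \<Phi>_mono y_cont t) auto
      then show "\<alpha> t \<le> y (Suc n) t \<and> y (Suc (Suc n)) t \<le> y (Suc n) t \<and> y (Suc n) t \<le> \<beta> t"
        using Suc t lo[OF t] by (auto simp: ySuc[of "Suc n"] ySuc[of n] intro: order_trans)
    qed
  qed
  have "\<exists>l. (\<lambda>n. y n t) \<longlonglongrightarrow> l" if t: "t \<in> {t0..T}" for t
  proof -
    have "decseq (\<lambda>n. y n t)" using y_between t by (intro decseq_SucI) auto
    moreover have "\<And>i. \<alpha> t \<le> y i t" using y_between t by auto
    ultimately show ?thesis using decseq_convergent by metis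
  qed
  then obtain l where l: "\<And>t. t \<in> {t0..T} \<Longrightarrow> (\<lambda>n. y n t) \<longlonglongrightarrow> l t"
    by metis
  define B where "B t = \<bar>h t (\<alpha> t)\<bar> + \<bar>h t (\<beta> t)\<bar>" for t
  have B_cont: "continuous_on {t0..T} B"
    unfolding B_def by (intro continuous_intros h_cont \<alpha>c \<beta>c)
  have B_dom: "\<bar>h t (y n t)\<bar> \<le> B t" if t: "t \<in> {t0..T}" for n t
  proof -
    have "h t (\<alpha> t) \<le> h t (y n t)" "h t (y n t) \<le> h t (\<beta> t)"
      using y_between[of n] t by (auto intro!: h_mono)
    then show ?thesis by (simp add: B_def)
  qed
  have hl: "(\<lambda>n. h t (y n t)) \<longlonglongrightarrow> h t (l t)" if t: "t \<in> {t0..T}" for t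
  proof -
    have "continuous_on UNIV (\<lambda>y::real. (t, y))"
      by (intro continuous_on_Pair continuous_on_const continuous_on_id)
    from continuous_on_compose2[OF f_cont this]
    have "continuous_on UNIV (f t)" using t by (auto simp: image_subset_iff)
    then have "continuous_on UNIV (h t)"
      unfolding h_def by (intro continuous_on_add continuous_on_mult_left continuous_on_id)
    then show ?thesis
      by (intro continuous_on_tendsto_compose[OF _ l[OF t]]) auto
  qed
  note dct = response_dominated_convergence[where g = "\<lambda>n t. h t (y n t)" and l = "\<lambda>t. h t (l t)",
      OF weighted_integrable[OF h_cont[OF y_cont]] B_cont B_dom hl]
  have l_fix: "l t = \<Phi> l t" if t: "t \<in> {t0..T}" for t
  proof (rule LIMSEQ_unique)
    show "(\<lambda>n. y (Suc n) t) \<longlonglongrightarrow> l t" using l[OF t] by (rule LIMSEQ_Suc)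
    show "(\<lambda>n. y (Suc n) t) \<longlonglongrightarrow> \<Phi> l t" unfolding ySuc \<Phi>_def using dct(2) t by simp
  qed
  \<comment> \<open>The limit is so far only a pointwise one. Being a value of the integral operator it is
    continuous, hence differentiable.\<close>
  have "continuous_on {t0..T} (\<Phi> l)"
    unfolding \<Phi>_def using dct(1) by (intro response_continuous) simp
  then have l_cont: "continuous_on {t0..T} l"
    using l_fix by (subst continuous_on_cong[OF refl, of _ _ "\<Phi> l"]) auto
  have "(\<Phi> l has_real_derivative f t (\<Phi> l t)) (at t within {t0..T})" if t: "t \<in> {t0..T}" for t
    using response_deriv[OF h_cont[OF l_cont] t] l_fix[OF t] by (simp add: \<Phi>_def h_def)
  moreover have "\<alpha> t \<le> \<Phi> l t \<and> \<Phi> l t \<le> \<beta> t" if t: "t \<in> {t0..T}" for t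
    using y_between t LIMSEQ_le_const[OF l[OF t]] LIMSEQ_le_const2[OF l[OF t]] l_fix[OF t] by metis
  moreover have "\<Phi> l t0 = \<Phi> l T"
    unfolding \<Phi>_def by (rule response_closed)
  ultimately show ?thesis by blast
qed

section \<open>Functions compared off a negligible set\<close>

lemma AE_lebesgue_on_imp_negligible:
  assumes "AE t in lebesgue_on S. Q t" "S \<in> sets lebesgue"
  shows "negligible {t \<in> S. \<not> Q t}"
proof -
  have "S \<inter> space lebesgue \<in> sets lebesgue"
    using assms(2) by (simp only: space_completion space_lborel space_borel Int_UNIV_right)
  then have "AE t in lebesgue. t \<in> S \<longrightarrow> Q t"
    using assms(1) by (simp only: AE_restrict_space_iff)
  then obtain N where N: "{t \<in> space lebesgue. \<not> (t \<in> S \<longrightarrow> Q t)} \<subseteq> N"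
      "emeasure lebesgue N = 0" "N \<in> sets lebesgue"
    by (rule AE_E)
  then have "negligible N"
    unfolding negligible_iff_null_sets by (intro null_setsI)
  then show ?thesis
    by (rule negligible_subset) (use N(1) in \<open>simp add: subset_iff\<close>)
qed

text \<open>The negative part of \<open>a\<close> is continuous and has integral zero, so it vanishes identically.\<close>

lemma continuous_nonneg_off_negligible:
  fixes a :: "real \<Rightarrow> real"
  assumes "t0 < T" "continuous_on {t0..T} a" "negligible {t \<in> {t0..T}. \<not> a t \<ge> 0}" "t \<in> {t0..T}"
  shows "a t \<ge> 0"
proof -
  have "integral {t0..T} (\<lambda>t. max 0 (- a t)) = integral {t0..T} (\<lambda>t. 0)"
    by (rule integral_spike[OF assms(3)]) auto
  then have zero: "integral {t0..T} (\<lambda>t. max 0 (- a t)) = 0"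
    by (simp only: integral_0)
  have cont: "continuous_on {t0..T} (\<lambda>t. max 0 (- a t))"
    by (intro continuous_on_max continuous_on_minus continuous_on_const assms(2))
  have "max 0 (- a t) = 0"
    using iffD1[OF integral_eq_0_iff[OF cont assms(1) max.cobounded1] zero] assms(4) by (rule bspec)
  then show ?thesis by linarith
qed

lemma integral_le_off_negligible:
  fixes f g :: "real \<Rightarrow> real"
  assumes f: "f integrable_on S" and g: "g integrable_on S" and N: "negligible N"
    and le: "\<And>x. x \<in> S - N \<Longrightarrow> f x \<le> g x"
  shows "integral S f \<le> integral S g"
proof -
  define g' where "g' x = (if x \<in> N then f x else g x)" for x
  have "g' integrable_on S"
    by (rule integrable_spike[OF g N]) (simp add: g'_def)
  then have "integral S f \<le> integral S g'"
    using le by (intro integral_le f) (auto simp: g'_def)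
  also have "\<dots> = integral S g"
    by (rule integral_spike[OF N]) (simp add: g'_def)
  finally show ?thesis .
qed

section \<open>The Abel equation\<close>

text \<open>
  The difference quotient of the cubic is \<open>a (u^2 + u v + v^2) + b (u + v) + c\<close>. Its bound supplies
  the constant \<open>K\<close> of the monotone iteration.
\<close>

lemma cubic_one_sided_lipschitz:
  fixes a b c A B C M u v :: real
  assumes "\<bar>a\<bar> \<le> A" "\<bar>b\<bar> \<le> B" "\<bar>c\<bar> \<le> C" "0 \<le> u" "u \<le> v" "v \<le> M"
  shows "a * v ^ 3 + b * v ^ 2 + c * v - (a * u ^ 3 + b * u ^ 2 + c * u)
           \<le> (3 * A * M\<^sup>2 + 2 * B * M + C) * (v - u)"
proof -
  have M: "0 \<le> M" "u \<le> M" "0 \<le> v" and "0 \<le> A" "0 \<le> B" using assms by linarith+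
  have "u\<^sup>2 \<le> M\<^sup>2" "v\<^sup>2 \<le> M\<^sup>2" "u * v \<le> M * M"
    using assms M by (auto intro: power_mono mult_mono)
  then have sq: "u\<^sup>2 + u * v + v\<^sup>2 \<le> 3 * M\<^sup>2" by (simp add: power2_eq_square)
  have "a * (u\<^sup>2 + u * v + v\<^sup>2) \<le> A * (3 * M\<^sup>2)"
    using assms sq M \<open>0 \<le> A\<close> by (intro mult_mono) auto
  moreover have "b * (u + v) \<le> B * (2 * M)"
    using assms M \<open>0 \<le> B\<close> by (intro mult_mono) auto
  ultimately have "a * (u\<^sup>2 + u * v + v\<^sup>2) + b * (u + v) + c \<le> 3 * A * M\<^sup>2 + 2 * B * M + C"
    using assms by (simp add: algebra_simps)
  then have "(a * (u\<^sup>2 + u * v + v\<^sup>2) + b * (u + v) + c) * (v - u)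
      \<le> (3 * A * M\<^sup>2 + 2 * B * M + C) * (v - u)"
    using assms by (intro mult_right_mono) auto
  then show ?thesis by (simp add: algebra_simps power2_eq_square power3_eq_cube)
qed

text \<open>
  The first three terms are a square divided by \<open>4 (a + \<epsilon>)\<close>, minus \<open>\<epsilon> y^2\<close>. For \<open>0 \<le> y \<le> M\<close> the term
  \<open>\<eta>\<close> covers the deficit.
\<close>

lemma regularized_square_completion:
  fixes a b \<epsilon> \<eta> y M :: real
  assumes "0 \<le> a" "0 < \<epsilon>" "\<epsilon> * M\<^sup>2 \<le> \<eta>" "0 \<le> y" "y \<le> M"
  shows "0 \<le> a * y\<^sup>2 + b * y + b\<^sup>2 / (4 * (a + \<epsilon>)) + \<eta>"
proof -
  have "\<epsilon> * y\<^sup>2 \<le> \<epsilon> * M\<^sup>2" using assms by (intro mult_left_mono power_mono) auto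
  then have "\<epsilon> * y\<^sup>2 \<le> \<eta>" using assms(3) by (rule order_trans)
  moreover have "(a + \<epsilon>) * y\<^sup>2 + b * y + b\<^sup>2 / (4 * (a + \<epsilon>)) = (2 * (a + \<epsilon>) * y + b)\<^sup>2 / (4 * (a + \<epsilon>))"
    using assms by (simp add: field_simps power2_eq_square)
  moreover have "0 \<le> (2 * (a + \<epsilon>) * y + b)\<^sup>2 / (4 * (a + \<epsilon>))"
    using assms by simp
  ultimately show ?thesis by (simp add: algebra_simps)
qed

text \<open>
  The upper solution is the periodic solution of \<open>\<beta>' = - (c - b^2 / (4 (a + \<epsilon>)) - \<eta>) \<beta> - d\<close>. Here \<open>\<eta>\<close>
  uses up half of the mean of \<open>c - b^2 / (4 a)\<close>, so the mean of the coefficient stays at least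
  half as large for every \<open>\<epsilon> > 0\<close>. Since \<open>0 \<le> b^2 / (4 (a + \<epsilon>)) \<le> b^2 / (4 a)\<close> almost everywhere, the bound
  \<open>M\<close> on \<open>\<beta>\<close> is independent of \<open>\<epsilon>\<close>, and \<open>\<epsilon>\<close> can be chosen afterwards with \<open>\<epsilon> M^2 \<le> \<eta>\<close>.
\<close>

lemma bounded_upper_solution:
  fixes a b c d :: "real \<Rightarrow> real"
  assumes t0T: "t0 < T"
    and cont: "continuous_on {t0..T} a" "continuous_on {t0..T} b"
      "continuous_on {t0..T} c" "continuous_on {t0..T} d"
    and N: "negligible {t \<in> {t0..T}. \<not> a t > 0}"
    and r: "(\<lambda>t. (b t)\<^sup>2 / (4 * a t)) integrable_on {t0..T}"
    and pos: "integral {t0..T} (\<lambda>t. c t - (b t)\<^sup>2 / (4 * a t)) > 0"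
    and d: "\<And>t. t \<in> {t0..T} \<Longrightarrow> d t \<le> 0"
  obtains \<beta> \<beta>' M where
    "\<And>t. t \<in> {t0..T} \<Longrightarrow> (\<beta> has_real_derivative \<beta>' t) (at t within {t0..T})"
    "\<And>t. t \<in> {t0..T} \<Longrightarrow> - (a t * \<beta> t ^ 3 + b t * \<beta> t ^ 2 + c t * \<beta> t + d t) \<le> \<beta>' t"
    "\<beta> t0 = \<beta> T" "\<And>t. t \<in> {t0..T} \<Longrightarrow> 0 \<le> \<beta> t" "\<And>t. t \<in> {t0..T} \<Longrightarrow> \<beta> t \<le> M"
proof -
  define I where "I = integral {t0..T} (\<lambda>t. c t - (b t)\<^sup>2 / (4 * a t))"
  define \<eta> where "\<eta> = I / (2 * (T - t0))"
  define C where "C = integral {t0..T} (\<lambda>t. \<bar>c t\<bar> + (b t)\<^sup>2 / (4 * a t) + \<eta>)"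
  define M where "M = exp C * (exp C * integral {t0..T} (\<lambda>t. - d t) * (1 / (exp (I / 2) - 1) + 1))"
  define \<epsilon> where "\<epsilon> = \<eta> / (M\<^sup>2 + 1)"
  define q where "q t = (b t)\<^sup>2 / (4 * (a t + \<epsilon>))" for t
  define p where "p t = c t - q t - \<eta>" for t
  have I: "I > 0" using pos by (simp add: I_def)
  have \<eta>: "\<eta> > 0" "\<eta> * (T - t0) = I / 2" using I t0T by (simp_all add: \<eta>_def divide_simps)
  have M1: "M\<^sup>2 + 1 > 0" by (simp add: add_nonneg_pos)
  have \<epsilon>: "\<epsilon> > 0" using \<eta>(1) M1 by (simp add: \<epsilon>_def)
  have \<epsilon>M: "\<epsilon> * M\<^sup>2 \<le> \<eta>"
    using \<eta>(1) M1 by (simp add: \<epsilon>_def divide_le_eq mult_left_mono)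
  have a: "a t \<ge> 0" if t: "t \<in> {t0..T}" for t
    by (rule continuous_nonneg_off_negligible[OF t0T cont(1) negligible_subset[OF N] t]) auto
  have q_cont: "continuous_on {t0..T} q"
    unfolding q_def by (intro continuous_intros cont) (use a \<epsilon> in force)
  have p_cont: "continuous_on {t0..T} p"
    unfolding p_def by (intro continuous_intros cont q_cont)
  have q0: "0 \<le> q t" if "t \<in> {t0..T}" for t
    using a[OF that] \<epsilon> by (simp add: q_def)
  have q_le: "q t \<le> (b t)\<^sup>2 / (4 * a t)" if "t \<in> {t0..T} - {t \<in> {t0..T}. \<not> a t > 0}" for t
    unfolding q_def using that \<epsilon> by (intro divide_left_mono) auto
  have c_int: "c integrable_on {t0..T}" by (intro integrable_continuous_real cont)
  have "I \<le> integral {t0..T} (\<lambda>t. c t - q t)"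
    unfolding I_def
  proof (rule integral_le_off_negligible[OF integrable_diff[OF c_int r] _ N])
    show "(\<lambda>t. c t - q t) integrable_on {t0..T}"
      by (intro integrable_continuous_real continuous_intros cont q_cont)
    fix t assume "t \<in> {t0..T} - {t \<in> {t0..T}. \<not> a t > 0}"
    then show "c t - (b t)\<^sup>2 / (4 * a t) \<le> c t - q t"
      by (intro diff_left_mono q_le)
  qed
  moreover have "integral {t0..T} p = integral {t0..T} (\<lambda>t. c t - q t) - \<eta> * (T - t0)"
    unfolding p_def using t0T
    by (subst integral_diff) (auto intro!: integrable_continuous_real continuous_intros cont q_cont)
  ultimately have p_int: "I / 2 \<le> integral {t0..T} p" using \<eta>(2) by simp
  interpret periodic_linear t0 T p
    using t0T p_cont p_int I by unfold_locales auto
  have "\<bar>P t\<bar> \<le> C" if t: "t \<in> {t0..T}" for t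
  proof -
    have pi: "(\<lambda>t. \<bar>p t\<bar>) integrable_on {t0..T}"
      by (intro integrable_continuous_real continuous_intros p_cont)
    have sub: "{t0..t} \<subseteq> {t0..T}" using t by auto
    have "norm (P t) \<le> integral {t0..t} (\<lambda>t. \<bar>p t\<bar>)"
      unfolding P_def
      by (intro integral_norm_bound_integral integrable_on_subinterval[OF pi sub]
          integrable_on_subinterval[OF integrable_continuous_real[OF p_cont] sub]) auto
    also have "\<dots> \<le> integral {t0..T} (\<lambda>t. \<bar>p t\<bar>)"
      by (intro integral_subset_le sub pi integrable_on_subinterval[OF pi sub]) auto
    also have "\<dots> \<le> C"
      unfolding C_def
    proof (rule integral_le_off_negligible[OF pi _ N])
      show "(\<lambda>t. \<bar>c t\<bar> + (b t)\<^sup>2 / (4 * a t) + \<eta>) integrable_on {t0..T}"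
        by (intro integrable_add r integrable_continuous_real continuous_intros cont)
      fix t assume t: "t \<in> {t0..T} - {t \<in> {t0..T}. \<not> a t > 0}"
      then show "\<bar>p t\<bar> \<le> \<bar>c t\<bar> + (b t)\<^sup>2 / (4 * a t) + \<eta>"
        using q0[of t] q_le[OF t] \<eta>(1) by (simp add: p_def)
    qed
    finally show ?thesis by simp
  qed
  moreover have md: "continuous_on {t0..T} (\<lambda>t. - d t)" by (intro continuous_intros cont)
  ultimately have le_M: "response (\<lambda>t. - d t) t \<le> M" if "t \<in> {t0..T}" for t
    unfolding M_def using d I p_int that by (intro response_bound) (auto simp: P_def)
  have ge_0: "0 \<le> response (\<lambda>t. - d t) t" if "t \<in> {t0..T}" for t
    using d that by (intro response_nonneg md) auto
  show thesis
  proof (rule that)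
    fix t assume t: "t \<in> {t0..T}"
    let ?y = "response (\<lambda>t. - d t) t"
    show "(response (\<lambda>t. - d t) has_real_derivative - d t - p t * ?y) (at t within {t0..T})"
      by (rule response_deriv[OF md t])
    show "0 \<le> ?y" "?y \<le> M" using ge_0 le_M t by auto
    have "0 \<le> ?y * (a t * ?y\<^sup>2 + b t * ?y + q t + \<eta>)"
      unfolding q_def using a \<epsilon> \<epsilon>M ge_0 le_M t
      by (intro mult_nonneg_nonneg regularized_square_completion[where M = M]) auto
    then show "- (a t * ?y ^ 3 + b t * ?y ^ 2 + c t * ?y + d t) \<le> - d t - p t * ?y"
      by (simp add: p_def algebra_simps power2_eq_square power3_eq_cube)
  next
    show "response (\<lambda>t. - d t) t0 = response (\<lambda>t. - d t) T" by (rule response_closed)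
  qed
qed

theorem theorem5p1:
  fixes t0 T :: real and a b c d :: "real \<Rightarrow> real"
  assumes "t0 < T"
    and "continuous_on {t0..T} a" and "continuous_on {t0..T} b"
    and "continuous_on {t0..T} c" and "continuous_on {t0..T} d"
    and "AE t in lebesgue_on {t0..T}. a t > 0"
    and "set_integrable lebesgue {t0..T} (\<lambda>t. (b t)\<^sup>2 / a t)"
    and "(LINT t:{t0..T}|lebesgue. c t - (b t)\<^sup>2 / (4 * a t)) > 0"
    and "\<forall>t\<in>{t0..T}. d t \<le> 0"
  shows "\<exists>y. closed_abel_solution_on t0 T a b c d y \<and> (\<forall>t\<in>{t0..T}. y t \<ge> 0)"
proof -
  have N: "negligible {t \<in> {t0..T}. \<not> a t > 0}"
    using assms(6) by (rule AE_lebesgue_on_imp_negligible) simp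
  have r: "(\<lambda>t. (b t)\<^sup>2 / (4 * a t)) absolutely_integrable_on {t0..T}"
    using set_integrable_mult_right[of "1/4", OF assms(7)] by (simp add: field_simps)
  have "(\<lambda>t. c t - (b t)\<^sup>2 / (4 * a t)) absolutely_integrable_on {t0..T}"
    by (intro set_integral_diff(1) absolutely_integrable_continuous_real assms r)
  then have pos: "integral {t0..T} (\<lambda>t. c t - (b t)\<^sup>2 / (4 * a t)) > 0"
    using assms(8) by (simp add: set_lebesgue_integral_eq_integral(2))
  obtain \<beta> \<beta>' M where \<beta>:
    "\<And>t. t \<in> {t0..T} \<Longrightarrow> (\<beta> has_real_derivative \<beta>' t) (at t within {t0..T})"
    "\<And>t. t \<in> {t0..T} \<Longrightarrow> - (a t * \<beta> t ^ 3 + b t * \<beta> t ^ 2 + c t * \<beta> t + d t) \<le> \<beta>' t"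
    "\<beta> t0 = \<beta> T" "\<And>t. t \<in> {t0..T} \<Longrightarrow> 0 \<le> \<beta> t" "\<And>t. t \<in> {t0..T} \<Longrightarrow> \<beta> t \<le> M"
    using bounded_upper_solution[OF assms(1-5) N set_lebesgue_integral_eq_integral(1)[OF r] pos]
      assms(9) by metis
  have bdd: "\<exists>B. \<forall>t\<in>{t0..T}. \<bar>g t\<bar> \<le> B" if "continuous_on {t0..T} g" for g :: "real \<Rightarrow> real"
    using compact_imp_bounded[OF compact_continuous_image[OF that compact_Icc]]
    by (auto simp: bounded_iff)
  obtain A B C where ABC: "\<forall>t\<in>{t0..T}. \<bar>a t\<bar> \<le> A" "\<forall>t\<in>{t0..T}. \<bar>b t\<bar> \<le> B" "\<forall>t\<in>{t0..T}. \<bar>c t\<bar> \<le> C"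
    using bdd[OF assms(2)] bdd[OF assms(3)] bdd[OF assms(4)] by blast
  have t0: "t0 \<in> {t0..T}" using assms(1) by simp
  have "0 \<le> A" "0 \<le> B" "0 \<le> C" using ABC t0 by (meson abs_ge_zero order_trans)+
  moreover have "0 \<le> M" using \<beta>(4,5)[OF t0] by simp
  ultimately have K: "0 < 3 * A * M\<^sup>2 + 2 * B * M + C + 1" (is "0 < ?K")
    by (simp add: add_nonneg_pos)
  define f where "f t y = - (a t * y ^ 3 + b t * y ^ 2 + c t * y + d t)" for t y
  have "\<exists>y. (\<forall>t\<in>{t0..T}. (y has_real_derivative f t (y t)) (at t within {t0..T})
                \<and> 0 \<le> y t \<and> y t \<le> \<beta> t) \<and> y t0 = y T"
  proof (rule closed_solution_between_lower_and_upper
      [where K = ?K and \<alpha> = "\<lambda>_. 0" and \<alpha>' = "\<lambda>_. 0" and \<beta>' = \<beta>', OF assms(1) _ K])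
    have "continuous_on ({t0..T} \<times> UNIV) (\<lambda>x::real \<times> real. g (fst x))"
      if "continuous_on {t0..T} g" for g :: "real \<Rightarrow> real"
      by (rule continuous_on_compose2[OF that]) (auto intro!: continuous_intros)
    note this[OF assms(2)] this[OF assms(3)] this[OF assms(4)] this[OF assms(5)]
    then show "continuous_on ({t0..T} \<times> UNIV) (\<lambda>(t, y). f t y)"
      unfolding f_def case_prod_beta by (intro continuous_intros)
  next
    fix t u v assume t: "t \<in> {t0..T}" and uv: "0 \<le> u" "u \<le> v" "v \<le> \<beta> t"
    have "a t * v ^ 3 + b t * v ^ 2 + c t * v - (a t * u ^ 3 + b t * u ^ 2 + c t * u)
            \<le> (3 * A * M\<^sup>2 + 2 * B * M + C) * (v - u)"
      using ABC t uv \<beta>(5)[OF t] by (intro cubic_one_sided_lipschitz) auto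
    then show "f t u + ?K * u \<le> f t v + ?K * v"
      using uv by (simp add: f_def algebra_simps)
  qed (use \<beta> assms(9) in \<open>auto simp: f_def\<close>)
  then obtain y where y: "\<And>t. t \<in> {t0..T} \<Longrightarrow> (y has_real_derivative f t (y t)) (at t within {t0..T})"
    "\<And>t. t \<in> {t0..T} \<Longrightarrow> 0 \<le> y t" "y t0 = y T"
    by blast
  have "abel_solution_on {t0..T} a b c d y"
    unfolding abel_solution_on_def
    by (intro ballI exI conjI, erule y(1)) (simp add: f_def)
  then show ?thesis
    using y(2,3) by (auto simp: closed_abel_solution_on_def)
qed

end
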